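(* Let $f\in\mathbb{R}\setminus\mathbb{Z}$. A minimal valid function $\pi$ (for $f$) is a facet if and only if for every minimal valid function $\pi'$ (for $f$), $E(\pi)\subseteq E(\pi')$ implies $\pi'=\pi$.
   Context: Fix $f\in\mathbb{R}\setminus\mathbb{Z}$. Let $F_f$ be the set of finite-support functions $y\colon\mathbb{R}\to\mathbb{Z}_+$ (nonnegative integers) with $\sum_{r\in\mathbb{R}} r\,y(r)\in f+\mathbb{Z}$. A function $\pi\colon\mathbb{R}\to\mathbb{R}$ is a valid function if $\pi\ge 0$ and $\sum_{r\in\mathbb{R}}\pi(r)y(r)\ge 1$ for all $y\in F_f$. A valid function $\pi$ is minimal if there is no valid function $\pi'\ne\pi$ with $\pi'\le\pi$ pointwise. For a valid function $\pi$ let $P(\pi)=\{y\in F_f : \sum_{r}\pi(r)y(r)=1\}$. A valid function $\pi$ is a facet if for every valid function $\pi'$ with $P(\pi)\subseteq P(\pi')$ one has $\pi'=\pi$. For a function $\pi\colon\mathbb{R}\to\mathbb{R}$, the additivity domain is $E(\pi)=\{(x,y)\in\mathbb{R}\times\mathbb{R} : \pi(x)+\pi(y)=\pi(x+y)\}$. *)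

theory Defs
  imports Complex_Main
begin

definition feasible :: "real \<Rightarrow> (real \<Rightarrow> nat) set" where
  "feasible f = {y. finite {r. y r \<noteq> 0} \<and>
                    (\<Sum>r | y r \<noteq> 0. r * real (y r)) \<in> (\<lambda>z. f + z) ` \<int>}"

text \<open>The paper's sums over all reals are written as sums over the finite support of \<open>y\<close>.\<close>

definition weight :: "(real \<Rightarrow> real) \<Rightarrow> (real \<Rightarrow> nat) \<Rightarrow> real" where
  "weight \<pi> y = (\<Sum>r | y r \<noteq> 0. \<pi> r * real (y r))"

definition valid :: "real \<Rightarrow> (real \<Rightarrow> real) \<Rightarrow> bool" where
  "valid f \<pi> \<longleftrightarrow> (\<forall>r. 0 \<le> \<pi> r) \<and> (\<forall>y \<in> feasible f. 1 \<le> weight \<pi> y)"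

definition minimal_valid :: "real \<Rightarrow> (real \<Rightarrow> real) \<Rightarrow> bool" where
  "minimal_valid f \<pi> \<longleftrightarrow> valid f \<pi> \<and> \<not> (\<exists>\<pi>'. valid f \<pi>' \<and> \<pi>' \<noteq> \<pi> \<and> (\<forall>r. \<pi>' r \<le> \<pi> r))"

definition tight_set :: "real \<Rightarrow> (real \<Rightarrow> real) \<Rightarrow> (real \<Rightarrow> nat) set" where
  "tight_set f \<pi> = {y \<in> feasible f. weight \<pi> y = 1}"

definition facet :: "real \<Rightarrow> (real \<Rightarrow> real) \<Rightarrow> bool" where
  "facet f \<pi> \<longleftrightarrow> valid f \<pi> \<and>
     (\<forall>\<pi>'. valid f \<pi>' \<and> tight_set f \<pi> \<subseteq> tight_set f \<pi>' \<longrightarrow> \<pi>' = \<pi>)"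

definition additivity_domain :: "(real \<Rightarrow> real) \<Rightarrow> (real \<times> real) set" where
  "additivity_domain \<pi> = {(x, y). \<pi> x + \<pi> y = \<pi> (x + y)}"

end

theory Submission
  imports Defs "HOL-Library.Multiset"
begin

text \<open>
  Lowering \<open>\<pi>\<close> while keeping it valid contradicts minimality; this forces a minimal \<open>\<pi>\<close> to vanish
  on the integers, to be subadditive and to satisfy \<open>\<pi> r + \<pi> (f - r) = 1\<close>. Conversely, a valid
  function with this symmetry is minimal. The points \<open>r, f - r\<close> and \<open>a, b, f - (a + b)\<close> for
  \<open>(a, b) \<in> E(\<pi>)\<close> form tight solutions, so \<open>P(\<pi>) \<subseteq> P(\<pi>')\<close> implies that \<open>\<pi>'\<close> is minimal and
  \<open>E(\<pi>) \<subseteq> E(\<pi>')\<close>. In the other direction, a tight solution has \<open>\<pi>\<close>-weight \<open>\<pi>\<close> of its sum, so by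
  subadditivity all its partial sums are additive for \<open>\<pi>\<close>, hence for \<open>\<pi>'\<close>.
\<close>

section \<open>Solutions as finite multisets of reals\<close>

lemma sum_mset_image_count:
  fixes g :: "'a \<Rightarrow> real"
  shows "(\<Sum>r | count M r \<noteq> 0. g r * real (count M r)) = (\<Sum>r\<in>#M. g r)"
proof -
  \<comment> \<open>The index set is a fixed finite \<open>S\<close>, as the support itself would
    change during the induction on \<open>M\<close>.\<close>
  have sum_superset: "(\<Sum>r\<in>S. g r * real (count M r)) = (\<Sum>r\<in>#M. g r)"
    if "finite S" "set_mset M \<subseteq> S" for S
    using that(2)
  proof (induction M)
    case (add x M)
    have "(\<Sum>r\<in>S. g r * real (count (add_mset x M) r)) =
        (\<Sum>r\<in>S. g r * real (count M r) + (if r = x then g r else 0))"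
      by (intro sum.cong) (auto simp: algebra_simps)
    then show ?case
      using add that(1) by (simp add: sum.distrib)
  qed simp
  have "{r. count M r \<noteq> 0} = set_mset M"
    by auto
  then show ?thesis
    by (simp add: sum_superset)
qed

lemma weight_count: "weight \<pi> (count M) = (\<Sum>r\<in>#M. \<pi> r)"
  unfolding weight_def by (rule sum_mset_image_count)

lemma count_mem_feasible_iff: "count M \<in> feasible f \<longleftrightarrow> sum_mset M - f \<in> \<int>"
proof -
  have "x \<in> (\<lambda>z. f + z) ` \<int> \<longleftrightarrow> x - f \<in> \<int>" for x :: real
    by (auto simp: image_iff intro!: bexI[of _ "x - f"])
  then show ?thesis
    using sum_mset_image_count[of "\<lambda>r. r" M]
    by (simp add: feasible_def)
qed

text \<open>Finite-support functions into the naturals are exactly the counts of multisets, so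
  quantifiers over solutions can range over multisets, which admit induction.\<close>

lemma ball_feasible_iff:
  "(\<forall>y\<in>feasible f. P y) \<longleftrightarrow> (\<forall>M. sum_mset M - f \<in> \<int> \<longrightarrow> P (count M))"
proof -
  have "\<exists>M. y = count M" if "y \<in> feasible f" for y
  proof
    from that have "finite {r. 0 < y r}"
      by (simp add: feasible_def)
    then show "y = count (Abs_multiset y)"
      by simp
  qed
  then show ?thesis
    by (metis count_mem_feasible_iff)
qed

lemma valid_iff_multiset:
  "valid f \<pi> \<longleftrightarrow> (\<forall>r. 0 \<le> \<pi> r) \<and> (\<forall>M. sum_mset M - f \<in> \<int> \<longrightarrow> 1 \<le> (\<Sum>r\<in>#M. \<pi> r))"
  unfolding valid_def ball_feasible_iff weight_count ..

lemma tight_set_subset_iff_multiset: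
  "tight_set f \<pi> \<subseteq> tight_set f \<pi>' \<longleftrightarrow>
    (\<forall>M. sum_mset M - f \<in> \<int> \<longrightarrow> (\<Sum>r\<in>#M. \<pi> r) = 1 \<longrightarrow> (\<Sum>r\<in>#M. \<pi>' r) = 1)"
proof -
  have "tight_set f \<pi> \<subseteq> tight_set f \<pi>' \<longleftrightarrow>
      (\<forall>y\<in>feasible f. weight \<pi> y = 1 \<longrightarrow> weight \<pi>' y = 1)"
    by (auto simp: tight_set_def)
  then show ?thesis
    unfolding ball_feasible_iff weight_count .
qed

lemma valid_nonneg: "valid f \<pi> \<Longrightarrow> 0 \<le> \<pi> r"
  by (simp add: valid_def)

lemma valid_sum_mset_ge_1: "valid f \<pi> \<Longrightarrow> sum_mset M - f \<in> \<int> \<Longrightarrow> 1 \<le> (\<Sum>r\<in>#M. \<pi> r)"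
  by (simp add: valid_iff_multiset)

lemma valid_pair_ge_1: "valid f \<pi> \<Longrightarrow> 1 \<le> \<pi> r + \<pi> (f - r)"
  using valid_sum_mset_ge_1[of f \<pi> "{#r, f - r#}"] by simp

lemma minimal_validD_eq:
  "minimal_valid f \<pi> \<Longrightarrow> valid f \<pi>' \<Longrightarrow> (\<And>r. \<pi>' r \<le> \<pi> r) \<Longrightarrow> \<pi>' = \<pi>"
  by (auto simp: minimal_valid_def)

text \<open>Replacing each entry \<open>r\<close> of a solution by its \<open>N\<close> keeps the
  sum modulo the integers and turns \<pi>'-weight into \<pi>-weight, which is at least 1. This
  validates the lowered functions used against minimality.\<close>

lemma valid_by_substitution:
  assumes "valid f \<pi>" and nonneg: "\<And>r. 0 \<le> \<pi>' r"
    and subst: "\<And>r. \<exists>N. sum_mset N - r \<in> \<int> \<and> (\<Sum>x\<in>#N. \<pi> x) = \<pi>' r"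
  shows "valid f \<pi>'"
proof -
  have replace: "\<exists>N. sum_mset N - sum_mset M \<in> \<int> \<and> (\<Sum>x\<in>#N. \<pi> x) = (\<Sum>x\<in>#M. \<pi>' x)" for M
  proof (induction M)
    case empty
    show ?case by (intro exI[of _ "{#}"]) simp
  next
    case (add r M)
    then obtain N where N: "sum_mset N - sum_mset M \<in> \<int>" "(\<Sum>x\<in>#N. \<pi> x) = (\<Sum>x\<in>#M. \<pi>' x)"
      by blast
    obtain K where K: "sum_mset K - r \<in> \<int>" "(\<Sum>x\<in>#K. \<pi> x) = \<pi>' r"
      using subst by blast
    have "(sum_mset K - r) + (sum_mset N - sum_mset M) \<in> \<int>"
      using N K by (intro Ints_add)
    with N K show ?case
      by (intro exI[of _ "K + N"]) (simp add: algebra_simps)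
  qed
  have "1 \<le> (\<Sum>r\<in>#M. \<pi>' r)" if M: "sum_mset M - f \<in> \<int>" for M
  proof -
    obtain N where N: "sum_mset N - sum_mset M \<in> \<int>" "(\<Sum>x\<in>#N. \<pi> x) = (\<Sum>x\<in>#M. \<pi>' x)"
      using replace by blast
    have "sum_mset N - f \<in> \<int>"
      using Ints_add[OF N(1) M] by simp
    with assms(1) N(2) show ?thesis
      by (metis valid_sum_mset_ge_1)
  qed
  with nonneg show ?thesis
    by (simp add: valid_iff_multiset)
qed

section \<open>Properties of minimal valid functions\<close>

lemma minimal_valid_Ints_eq_0:
  assumes "minimal_valid f \<pi>" "z \<in> \<int>"
  shows "\<pi> z = 0"
proof -
  define \<pi>' where "\<pi>' r = (if r \<in> \<int> then 0 else \<pi> r)" for r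
  have v: "valid f \<pi>"
    using assms(1) by (simp add: minimal_valid_def)
  have "0 \<le> \<pi>' r" for r
    using valid_nonneg[OF v] by (simp add: \<pi>'_def)
  moreover have "\<exists>N. sum_mset N - r \<in> \<int> \<and> (\<Sum>x\<in>#N. \<pi> x) = \<pi>' r" for r
    \<comment> \<open>Integer entries can simply be dropped from a solution.\<close>
    by (intro exI[of _ "if r \<in> \<int> then {#} else {#r#}"]) (simp add: \<pi>'_def)
  ultimately have "valid f \<pi>'"
    by (rule valid_by_substitution[OF v])
  moreover have "\<pi>' r \<le> \<pi> r" for r
    using valid_nonneg[OF v] by (simp add: \<pi>'_def)
  ultimately have "\<pi>' = \<pi>"
    by (rule minimal_validD_eq[OF assms(1)])
  then have "\<pi> z = \<pi>' z"
    by simp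
  with assms(2) show ?thesis
    by (simp add: \<pi>'_def)
qed

lemma minimal_valid_subadditive:
  assumes "minimal_valid f \<pi>"
  shows "\<pi> (a + b) \<le> \<pi> a + \<pi> b"
proof (rule ccontr)
  assume less: "\<not> \<pi> (a + b) \<le> \<pi> a + \<pi> b"
  define \<pi>' where "\<pi>' r = (if r = a + b then \<pi> a + \<pi> b else \<pi> r)" for r
  have v: "valid f \<pi>"
    using assms by (simp add: minimal_valid_def)
  have "0 \<le> \<pi>' r" for r
    using valid_nonneg[OF v] by (simp add: \<pi>'_def)
  moreover have "\<exists>N. sum_mset N - r \<in> \<int> \<and> (\<Sum>x\<in>#N. \<pi> x) = \<pi>' r" for r
    \<comment> \<open>An entry \<open>a + b\<close> is split into the cheaper pair \<open>a\<close>,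
      \<open>b\<close>.\<close>
    by (intro exI[of _ "if r = a + b then {#a, b#} else {#r#}"]) (simp add: \<pi>'_def)
  ultimately have "valid f \<pi>'"
    by (rule valid_by_substitution[OF v])
  moreover have "\<pi>' r \<le> \<pi> r" for r
    using less by (simp add: \<pi>'_def)
  ultimately have "\<pi>' = \<pi>"
    by (rule minimal_validD_eq[OF assms])
  then have "\<pi> (a + b) = \<pi>' (a + b)"
    by simp
  with less show False
    by (simp add: \<pi>'_def)
qed

lemma minimal_valid_periodic:
  assumes "minimal_valid f \<pi>" "x - y \<in> \<int>"
  shows "\<pi> x = \<pi> y"
proof -
  have "y - x \<in> \<int>"
    using assms(2) by (metis Ints_minus minus_diff_eq)
  then show ?thesis
    using minimal_valid_subadditive[OF assms(1), of y "x - y"]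
      minimal_valid_subadditive[OF assms(1), of x "y - x"]
      minimal_valid_Ints_eq_0[OF assms(1)] assms(2)
    by fastforce
qed

lemma minimal_valid_sum_mset:
  assumes "minimal_valid f \<pi>"
  shows "\<pi> (sum_mset M) \<le> (\<Sum>r\<in>#M. \<pi> r)"
proof (induction M)
  case empty
  then show ?case
    using minimal_valid_Ints_eq_0[OF assms, of 0] by simp
next
  case (add r M)
  with minimal_valid_subadditive[OF assms, of r "sum_mset M"] show ?case
    by simp
qed

text \<open>
  If \<open>d = \<pi> r + \<pi> (f - r)\<close> exceeded 1, every solution using \<open>r\<close> would have weight at least \<open>d\<close>, so
  \<open>\<pi> r\<close> could be divided by \<open>d\<close>.
\<close>
lemma minimal_valid_symmetric_pos:
  assumes "minimal_valid f \<pi>" "0 < \<pi> r"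
  shows "\<pi> r + \<pi> (f - r) = 1"
proof -
  have v: "valid f \<pi>"
    using assms(1) by (simp add: minimal_valid_def)
  define d where "d = \<pi> r + \<pi> (f - r)"
  have d: "1 \<le> d"
    using valid_pair_ge_1[OF v] by (simp add: d_def)
  define \<pi>' where "\<pi>' x = (if x = r then \<pi> r / d else \<pi> x)" for x
  have nonneg: "0 \<le> \<pi>' x" for x
    using d valid_nonneg[OF v] by (simp add: \<pi>'_def)
  \<comment> \<open>The lower bound serves validity of \<pi>', the upper one the appeal to
    minimality.\<close>
  have scaled: "\<pi> x / d \<le> \<pi>' x" "\<pi>' x \<le> \<pi> x" for x
    using d valid_nonneg[OF v, of x] by (auto simp: \<pi>'_def divide_le_eq mult_le_cancel_left1)
  have "1 \<le> (\<Sum>x\<in>#M. \<pi>' x)" if M: "sum_mset M - f \<in> \<int>" for M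
  proof (cases "r \<in># M")
    case False
    then have "(\<Sum>x\<in>#M. \<pi>' x) = (\<Sum>x\<in>#M. \<pi> x)"
      by (intro arg_cong[of _ _ sum_mset] image_mset_cong) (auto simp: \<pi>'_def)
    then show ?thesis
      using valid_sum_mset_ge_1[OF v M] by simp
  next
    case True
    then obtain N where N: "M = add_mset r N"
      by (metis insert_DiffM)
    \<comment> \<open>The entries other than one copy of \<open>r\<close> sum to
      \<open>f - r\<close> modulo the integers, so by subadditivity and periodicity they weigh at
      least \<open>\<pi> (f - r)\<close>.\<close>
    have "sum_mset N - (f - r) \<in> \<int>"
      using M by (simp add: N algebra_simps)
    then have "\<pi> (f - r) \<le> (\<Sum>x\<in>#N. \<pi> x)"
      using minimal_valid_periodic[OF assms(1)] minimal_valid_sum_mset[OF assms(1)] by metis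
    then have "d \<le> (\<Sum>x\<in>#M. \<pi> x)"
      by (simp add: N d_def)
    then have "1 \<le> (\<Sum>x\<in>#M. \<pi> x) / d"
      using d by simp
    also have "\<dots> = (\<Sum>x\<in>#M. \<pi> x / d)"
      by (induction M) (simp_all add: add_divide_distrib)
    also have "\<dots> \<le> (\<Sum>x\<in>#M. \<pi>' x)"
      by (intro sum_mset_mono scaled)
    finally show ?thesis .
  qed
  with nonneg have "valid f \<pi>'"
    by (simp add: valid_iff_multiset)
  then have "\<pi>' = \<pi>"
    by (intro minimal_validD_eq[OF assms(1)] scaled)
  then have "\<pi>' r = \<pi> r"
    by simp
  then have "\<pi> r / d = \<pi> r"
    by (simp add: \<pi>'_def)
  with assms(2) d have "d = 1"
    by (simp add: divide_eq_eq)
  then show ?thesis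
    by (simp add: d_def)
qed

lemma minimal_valid_symmetric:
  assumes "minimal_valid f \<pi>"
  shows "\<pi> r + \<pi> (f - r) = 1"
proof -
  have v: "valid f \<pi>"
    using assms by (simp add: minimal_valid_def)
  then have "0 < \<pi> r \<or> 0 < \<pi> (f - r)"
    using valid_pair_ge_1[OF v, of r] valid_nonneg[OF v] by linarith
  then show ?thesis
    using minimal_valid_symmetric_pos[OF assms, of r]
      minimal_valid_symmetric_pos[OF assms, of "f - r"] by auto
qed

lemma minimal_valid_eq_1:
  assumes "minimal_valid f \<pi>" "x - f \<in> \<int>"
  shows "\<pi> x = 1"
  using minimal_valid_symmetric[OF assms(1), of 0] minimal_valid_Ints_eq_0[OF assms(1), of 0]
    minimal_valid_periodic[OF assms] by simp

text \<open>A valid function below \<pi> still has sum at least 1 on each pair \<open>r\<close>,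
  \<open>f - r\<close>, so neither value can drop.\<close>

lemma minimal_validI_symmetric:
  assumes v: "valid f \<pi>" and sym: "\<And>r. \<pi> r + \<pi> (f - r) = 1"
  shows "minimal_valid f \<pi>"
proof -
  have "\<pi>' r = \<pi> r" if "valid f \<pi>'" "\<And>r. \<pi>' r \<le> \<pi> r" for \<pi>' r
    using valid_pair_ge_1[OF that(1), of r] sym[of r] that(2)[of r] that(2)[of "f - r"] by linarith
  with v show ?thesis
    unfolding minimal_valid_def by blast
qed

section \<open>Additivity domains and tight solutions\<close>

lemma sum_mset_additive_transfer:
  assumes "minimal_valid f \<pi>" "minimal_valid f \<pi>'"
    and sub: "additivity_domain \<pi> \<subseteq> additivity_domain \<pi>'"
    and "(\<Sum>r\<in>#M. \<pi> r) = \<pi> (sum_mset M)"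
  shows "(\<Sum>r\<in>#M. \<pi>' r) = \<pi>' (sum_mset M)"
  using assms(4)
proof (induction M)
  case empty
  then show ?case
    using minimal_valid_Ints_eq_0[OF assms(2), of 0] by simp
next
  case (add r M)
  have eq: "\<pi> r + (\<Sum>x\<in>#M. \<pi> x) = \<pi> (r + sum_mset M)"
    using add.prems by simp
  note ineq = minimal_valid_subadditive[OF assms(1), of r "sum_mset M"]
    minimal_valid_sum_mset[OF assms(1), of M]
  \<comment> \<open>Both inequalities in \<open>ineq\<close> must be equalities: the first makes
    \<open>(r, sum_mset M)\<close> an additive pair, the second feeds the induction
    hypothesis.\<close>
  have "\<pi> r + \<pi> (sum_mset M) = \<pi> (r + sum_mset M)"
    using eq ineq by linarith
  then have "\<pi>' r + \<pi>' (sum_mset M) = \<pi>' (r + sum_mset M)"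
    using sub by (auto simp: additivity_domain_def)
  moreover have "(\<Sum>x\<in>#M. \<pi> x) = \<pi> (sum_mset M)"
    using eq ineq by linarith
  ultimately show ?case
    using add.IH by simp
qed

text \<open>Both functions equal 1 on \<open>f\<close> plus the integers, so for solutions tightness
  says that the weight equals the value at the sum.\<close>

lemma tight_set_mono:
  assumes "minimal_valid f \<pi>" "minimal_valid f \<pi>'"
    and "additivity_domain \<pi> \<subseteq> additivity_domain \<pi>'"
  shows "tight_set f \<pi> \<subseteq> tight_set f \<pi>'"
  unfolding tight_set_subset_iff_multiset
  by (simp add: sum_mset_additive_transfer[OF assms] minimal_valid_eq_1[OF assms(1)]
      minimal_valid_eq_1[OF assms(2)])

lemma symmetric_of_tight_set_subset:
  assumes "minimal_valid f \<pi>" "tight_set f \<pi> \<subseteq> tight_set f \<pi>'"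
  shows "\<pi>' r + \<pi>' (f - r) = 1"
  using assms(2)[unfolded tight_set_subset_iff_multiset, rule_format, of "{#r, f - r#}"]
    minimal_valid_symmetric[OF assms(1)] by simp

lemma additivity_domain_mono:
  assumes "minimal_valid f \<pi>" "tight_set f \<pi> \<subseteq> tight_set f \<pi>'"
  shows "additivity_domain \<pi> \<subseteq> additivity_domain \<pi>'"
proof -
  have "\<pi>' a + \<pi>' b = \<pi>' (a + b)" if "\<pi> a + \<pi> b = \<pi> (a + b)" for a b
  proof -
    \<comment> \<open>This triple is tight for \<pi>, hence for \<pi>'; comparing it with the tight
      pair \<open>a + b\<close>, \<open>f - (a + b)\<close> cancels the last term.\<close>
    have "\<pi>' a + \<pi>' b + \<pi>' (f - (a + b)) = 1"
      using assms(2)[unfolded tight_set_subset_iff_multiset, rule_format,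
          of "{#a, b, f - (a + b)#}"]
        that minimal_valid_symmetric[OF assms(1), of "a + b"] by simp
    then show ?thesis
      using symmetric_of_tight_set_subset[OF assms, of "a + b"] by simp
  qed
  then show ?thesis
    by (auto simp: additivity_domain_def)
qed

theorem theorem4p3:
  fixes f :: real and \<pi> :: "real \<Rightarrow> real"
  assumes "f \<notin> \<int>"
    and "minimal_valid f \<pi>"
  shows "facet f \<pi> \<longleftrightarrow>
    (\<forall>\<pi>'. minimal_valid f \<pi>' \<longrightarrow>
       additivity_domain \<pi> \<subseteq> additivity_domain \<pi>' \<longrightarrow> \<pi>' = \<pi>)"
proof
  assume "facet f \<pi>"
  then show "\<forall>\<pi>'. minimal_valid f \<pi>' \<longrightarrow>
      additivity_domain \<pi> \<subseteq> additivity_domain \<pi>' \<longrightarrow> \<pi>' = \<pi>"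
    using tight_set_mono[OF assms(2)] by (auto simp: facet_def minimal_valid_def)
next
  assume unique: "\<forall>\<pi>'. minimal_valid f \<pi>' \<longrightarrow>
      additivity_domain \<pi> \<subseteq> additivity_domain \<pi>' \<longrightarrow> \<pi>' = \<pi>"
  \<comment> \<open>The inherited symmetry makes \<pi>' minimal, so \<open>unique\<close> applies to
    it.\<close>
  have "\<pi>' = \<pi>" if "valid f \<pi>'" "tight_set f \<pi> \<subseteq> tight_set f \<pi>'" for \<pi>'
    using unique minimal_validI_symmetric[OF that(1)]
      symmetric_of_tight_set_subset[OF assms(2) that(2)]
      additivity_domain_mono[OF assms(2) that(2)] by blast
  with assms(2) show "facet f \<pi>"
    by (simp add: facet_def minimal_valid_def)
qed

end
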